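(* There exists a smooth saddle surface $\Sigma\subset\mathbb{R}^3$ (complete, with Gauss curvature $K\le 0$) which is diffeomorphic to the plane $\mathbb{R}^2$ and on which there are infinitely many closed asymptotic curves, each of which encloses a non-planar region of $\Sigma$.
   Context: A saddle surface is a complete regular (smooth, immersed) surface in $\mathbb{R}^3$ whose Gauss curvature satisfies $K\le 0$ everywhere. An asymptotic curve is a smooth regular curve $\alpha$ on the surface whose normal curvature vanishes everywhere, i.e. $\mathrm{II}(\dot\alpha,\dot\alpha)=0$ along $\alpha$, where $\mathrm{II}$ is the second fundamental form. The closed asymptotic curves here are simple closed curves; since $\Sigma$ is homeomorphic to the plane, by the Jordan curve theorem such a curve is the boundary of a unique relatively compact region (a disc) of $\Sigma$, the region it encloses. A region of $\Sigma$ is planar if, with the induced metric, it is isometric to a region in the Euclidean plane; it is non-planar otherwise. *)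

theory Defs
  imports "HOL-Analysis.Analysis"
begin

(* Meaningful for open S only: the derivatives are two-sided ones at the points of S. *)
primrec Ck_on :: "nat \<Rightarrow> 'a::real_normed_vector set \<Rightarrow> ('a \<Rightarrow> 'b::real_normed_vector) \<Rightarrow> bool" where
  "Ck_on 0 S f \<longleftrightarrow> continuous_on S f"
| "Ck_on (Suc k) S f \<longleftrightarrow>
     (\<forall>x\<in>S. f differentiable (at x)) \<and>
     (\<forall>v. Ck_on k S (\<lambda>x. frechet_derivative f (at x) v))"

definition smooth_on :: "'a::real_normed_vector set \<Rightarrow> ('a \<Rightarrow> 'b::real_normed_vector) \<Rightarrow> bool" where
  "smooth_on S f \<longleftrightarrow> (\<forall>k. Ck_on k S f)"

(* An immersed surface diffeomorphic to the plane is represented by an immersion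
   f of the parameter plane real^2; points, curves and regions of the surface
   are points, curves and regions of the parameter plane, and all metric notions
   are those induced by f. *)
definition immersed_plane :: "(real^2 \<Rightarrow> real^3) \<Rightarrow> bool" where
  "immersed_plane f \<longleftrightarrow> smooth_on UNIV f \<and> (\<forall>p. inj (frechet_derivative f (at p)))"

definition first_form :: "(real^2 \<Rightarrow> real^3) \<Rightarrow> real^2 \<Rightarrow> real^2 \<Rightarrow> real^2 \<Rightarrow> real" where
  "first_form f p u v = frechet_derivative f (at p) u \<bullet> frechet_derivative f (at p) v"

definition unit_normal :: "(real^2 \<Rightarrow> real^3) \<Rightarrow> real^2 \<Rightarrow> real^3" where
  "unit_normal f p =
     sgn (cross3 (frechet_derivative f (at p) (axis 1 1)) (frechet_derivative f (at p) (axis 2 1)))"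

definition second_form :: "(real^2 \<Rightarrow> real^3) \<Rightarrow> real^2 \<Rightarrow> real^2 \<Rightarrow> real^2 \<Rightarrow> real" where
  "second_form f p u v =
     frechet_derivative (\<lambda>q. frechet_derivative f (at q) u) (at p) v \<bullet> unit_normal f p"

definition gauss_curvature :: "(real^2 \<Rightarrow> real^3) \<Rightarrow> real^2 \<Rightarrow> real" where
  "gauss_curvature f p =
     det (\<chi> i j. second_form f p (axis i 1) (axis j 1)) /
     det (\<chi> i j. first_form f p (axis i 1) (axis j 1))"

(* Riemannian distance: infimum of the lengths of piecewise C1 paths.
   Library piecewise C1 paths need not have a bounded derivative near their
   exceptional points; has_integral restricts to those of finite length (the
   total integral operator would assign length 0 to the others). *)
definition induced_dist :: "(real^2 \<Rightarrow> real^3) \<Rightarrow> real^2 \<Rightarrow> real^2 \<Rightarrow> real" where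
  "induced_dist f p q =
     Inf {L. \<exists>\<gamma>. valid_path \<gamma> \<and> pathstart \<gamma> = p \<and> pathfinish \<gamma> = q \<and>
            ((\<lambda>t. sqrt (first_form f (\<gamma> t) (vector_derivative \<gamma> (at t)) (vector_derivative \<gamma> (at t))))
               has_integral L) {0..1}}"

definition complete_surface :: "(real^2 \<Rightarrow> real^3) \<Rightarrow> bool" where
  "complete_surface f \<longleftrightarrow> Metric_space.mcomplete UNIV (induced_dist f)"

definition saddle_plane :: "(real^2 \<Rightarrow> real^3) \<Rightarrow> bool" where
  "saddle_plane f \<longleftrightarrow>
     immersed_plane f \<and> complete_surface f \<and> (\<forall>p. gauss_curvature f p \<le> 0)"

(* A smooth simple closed curve is given by a smooth 1-periodic map, injective on one period. *)
definition closed_asymptotic_curve :: "(real^2 \<Rightarrow> real^3) \<Rightarrow> (real \<Rightarrow> real^2) \<Rightarrow> bool" where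
  "closed_asymptotic_curve f c \<longleftrightarrow>
     smooth_on UNIV c \<and>
     (\<forall>t. c (t + 1) = c t) \<and>
     inj_on c {0..<1} \<and>
     (\<forall>t. vector_derivative c (at t) \<noteq> 0) \<and>
     (\<forall>t. second_form f (c t) (vector_derivative c (at t)) (vector_derivative c (at t)) = 0)"

(* D is an open region of the surface. *)
definition planar_region :: "(real^2 \<Rightarrow> real^3) \<Rightarrow> (real^2) set \<Rightarrow> bool" where
  "planar_region f D \<longleftrightarrow>
     (\<exists>(U :: (real^2) set) g. open U \<and> connected U \<and> bij_betw g D U \<and> smooth_on D g \<and>
        (\<forall>p\<in>D. \<forall>u v. frechet_derivative g (at p) u \<bullet> frechet_derivative g (at p) v
                        = first_form f p u v))"

end

theory Submission
  imports Defs
begin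

text \<open>
  The surface is the graph of \<open>z = x\<^sup>4 - y\<^sup>4\<close>.  Its Hessian is the diagonal matrix with entries
  \<open>12 x\<^sup>2\<close> and \<open>-12 y\<^sup>2\<close>, so the Gauss curvature is nonpositive and vanishes only on the two coordinate
  axes.  The asymptotic directions satisfy \<open>x\<^sup>2 dx\<^sup>2 = y\<^sup>2 dy\<^sup>2\<close>, and one solution is \<open>x dx + y dy = 0\<close>:
  every circle \<open>x\<^sup>2 + y\<^sup>2 = r\<^sup>2\<close> of the parameter plane is a closed asymptotic curve
  (\<open>closed_asymptotic_circle\<close>).  On a surface of negative curvature this could not happen, because the
  asymptotic directions would form line fields without singularities on the enclosed disc.  Here the field
  of directions tangent to the circles is singular at the origin, where the second fundamental form
  vanishes.

  The surface is complete because the projection of a graph to its parameter plane does not increase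
  lengths.  This is carried out for any immersion whose derivative does not shrink vectors
  (\<open>complete_surface_if_expanding\<close>).

  The disc enclosed by a circle contains points of negative curvature, so it is not planar by the
  Theorema Egregium.  For this surface there is a shorter argument (\<open>not_planar_ball\<close>).  The graph is a
  translation surface, the sum of a curve over the \<open>x\<close>-axis and a curve over the \<open>y\<close>-axis, and an
  isometry into the plane would have to be a sum of two plane curves as well.  Comparing the angles
  between their tangents at the corners of a square gives a contradiction.  The step from the
  metric to the sum of curves needs the symmetry of mixed second derivatives
  (\<open>second_derivative_symmetric\<close>).
\<close>

section \<open>Smooth maps\<close>

text \<open>
  Smoothness is coinductive: a class of differentiable maps that is closed under directional
  derivatives consists of smooth maps.  Closure properties of smooth maps under products and
  compositions are thereby avoided; it is enough to exhibit such a class around the given map.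
\<close>

lemma smooth_on_coinduct:
  assumes "P f"
    and deriv: "\<And>f x. P f \<Longrightarrow> f differentiable (at x)"
    and closed: "\<And>f v. P f \<Longrightarrow> P (\<lambda>x. frechet_derivative f (at x) v)"
  shows "smooth_on UNIV f"
proof -
  have "Ck_on k UNIV f" if "P f" for k f
    using that
  proof (induction k arbitrary: f)
    case 0
    then show ?case
      by (simp add: deriv differentiable_imp_continuous_within continuous_on_eq_continuous_within)
  qed (simp add: deriv closed)
  then show ?thesis
    using \<open>P f\<close> by (simp add: smooth_on_def)
qed

lemma smooth_on_differentiable:
  "smooth_on S f \<Longrightarrow> x \<in> S \<Longrightarrow> f differentiable (at x)"
  unfolding smooth_on_def by (metis Ck_on.simps(2))

lemma smooth_on_directional_derivative:
  "smooth_on S f \<Longrightarrow> smooth_on S (\<lambda>x. frechet_derivative f (at x) v)"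
  unfolding smooth_on_def by (metis Ck_on.simps(2))

lemma smooth_on_continuous: "smooth_on S f \<Longrightarrow> continuous_on S f"
  unfolding smooth_on_def by (metis Ck_on.simps(1))

text \<open>
  The derivative is found together with its polynomiality, because the product rule needs both for
  the factors.
\<close>

lemma real_polynomial_function_derivative:
  assumes "real_polynomial_function p"
  shows "\<exists>p'. (\<forall>x. (p has_derivative p' x) (at x)) \<and> (\<forall>v. real_polynomial_function (\<lambda>x. p' x v))"
  using assms
proof induction
  case (linear f)
  then show ?case
    by (auto intro!: exI[of _ "\<lambda>x. f"] bounded_linear_imp_has_derivative)
next
  case (const c)
  show ?case by (auto intro!: exI[of _ "\<lambda>x v. 0"])
next
  case (add f g)
  then obtain f' g' where "\<And>x. (f has_derivative f' x) (at x)" "\<And>v. real_polynomial_function (\<lambda>x. f' x v)"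
     "\<And>x. (g has_derivative g' x) (at x)" "\<And>v. real_polynomial_function (\<lambda>x. g' x v)" by blast
  then show ?case
    by (intro exI[of _ "\<lambda>x v. f' x v + g' x v"]) (auto intro: derivative_intros)
next
  case (mult f g)
  then obtain f' g' where der: "\<And>x. (f has_derivative f' x) (at x)" "\<And>x. (g has_derivative g' x) (at x)"
    and poly: "\<And>v. real_polynomial_function (\<lambda>x. f' x v)" "\<And>v. real_polynomial_function (\<lambda>x. g' x v)"
    by blast
  have "real_polynomial_function (\<lambda>x. f x * g' x v + f' x v * g x)" for v
    using mult.hyps poly by (intro real_polynomial_function.intros(3,4))
  then show ?case
    using has_derivative_mult[OF der] by (intro exI[of _ "\<lambda>x v. f x * g' x v + f' x v * g x"]) auto
qed

lemma smooth_on_polynomial_function: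
  fixes f :: "'a::euclidean_space \<Rightarrow> 'b::euclidean_space"
  assumes "polynomial_function f"
  shows "smooth_on UNIV f"
proof (rule smooth_on_coinduct[where P = polynomial_function])
  fix f :: "'a \<Rightarrow> 'b" and v
  assume f: "polynomial_function f"
  show diff: "f differentiable (at x)" for x
    using f by (rule differentiable_at_polynomial_function)
  show "polynomial_function (\<lambda>x. frechet_derivative f (at x) v)"
    unfolding polynomial_function_iff_Basis_inner
  proof
    fix b :: 'b
    assume "b \<in> Basis"
    then have "real_polynomial_function (\<lambda>x. f x \<bullet> b)"
      using f by (simp add: polynomial_function_iff_Basis_inner)
    from real_polynomial_function_derivative[OF this]
    obtain p' where "(\<forall>x. ((\<lambda>x. f x \<bullet> b) has_derivative p' x) (at x)) \<and>
        (\<forall>v. real_polynomial_function (\<lambda>x. p' x v))" ..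
    then have p': "((\<lambda>x. f x \<bullet> b) has_derivative p' x) (at x)"
      and poly: "real_polynomial_function (\<lambda>x. p' x v)" for x
      by simp_all
    have "((\<lambda>x. f x \<bullet> b) has_derivative (\<lambda>v. frechet_derivative f (at x) v \<bullet> b)) (at x)" for x
      by (rule has_derivative_inner_left) (use diff frechet_derivative_works in blast)
    from has_derivative_unique[OF this p']
    have "frechet_derivative f (at x) v \<bullet> b = p' x v" for x
      by (rule fun_cong)
    then show "real_polynomial_function (\<lambda>x. frechet_derivative f (at x) v \<bullet> b)"
      using poly by simp
  qed
qed (use assms in simp)

section \<open>The induced distance and completeness\<close>

text \<open>
  A relation rather than a function: a valid path need not have a finite length.
\<close>

definition has_length :: "(real^2 \<Rightarrow> real^3) \<Rightarrow> (real \<Rightarrow> real^2) \<Rightarrow> real \<Rightarrow> bool" where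
  "has_length f \<gamma> L \<longleftrightarrow> valid_path \<gamma> \<and>
     ((\<lambda>t. norm (frechet_derivative f (at (\<gamma> t)) (vector_derivative \<gamma> (at t)))) has_integral L) {0..1}"

lemma induced_dist_eq_Inf_has_length:
  "induced_dist f p q = Inf {L. \<exists>\<gamma>. has_length f \<gamma> L \<and> pathstart \<gamma> = p \<and> pathfinish \<gamma> = q}"
  by (simp add: induced_dist_def has_length_def first_form_def norm_eq_sqrt_inner conj_ac)

lemma has_length_nonneg: "has_length f \<gamma> L \<Longrightarrow> 0 \<le> L"
  unfolding has_length_def by (auto intro: has_integral_nonneg)

lemma has_length_reversepath:
  assumes f: "\<And>x. f differentiable (at x)" and "has_length f g L"
  shows "has_length f (reversepath g) L"
proof -
  obtain S where S: "continuous_on {0..1} g" "finite S" "g C1_differentiable_on {0..1} - S"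
    using assms by (auto simp: has_length_def valid_path_def piecewise_C1_differentiable_on_def)
  define F where "F = (\<lambda>t. norm (frechet_derivative f (at (g t)) (vector_derivative g (at t))))"
  have F: "(F has_integral L) {0..1}"
    using assms by (simp add: has_length_def F_def)
  have *: "norm (frechet_derivative f (at (reversepath g x)) (vector_derivative (reversepath g) (at x))) = F (1 - x)"
    if xs: "x \<in> {0..1} - (\<lambda>x. 1 - x) ` S" for x
  proof -
    have "1 - x \<in> {0..1} - S"
      using that by force
    then obtain f' where f': "(g has_vector_derivative f') (at (1 - x))"
      using S(3) by (force simp: C1_differentiable_on_def)
    have "(g \<circ> (\<lambda>x. 1 - x) has_vector_derivative -1 *\<^sub>R f') (at x)"
      by (rule vector_diff_chain_at) (auto intro!: derivative_eq_intros f')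
    then have "vector_derivative (reversepath g) (at x) = - f'"
      by (auto simp: o_def reversepath_def intro: vector_derivative_at)
    moreover have "vector_derivative g (at (1 - x)) = f'"
      using f' by (rule vector_derivative_at)
    moreover have "linear (frechet_derivative f (at (g (1 - x))))"
      using f by (rule linear_frechet_derivative)
    ultimately show ?thesis
      by (simp add: F_def reversepath_def linear_neg)
  qed
  have "((\<lambda>x. F (1 - x)) has_integral L) {0..1}"
    using has_integral_affinity01 [OF F, where m= "-1" and c=1] by simp
  then have "((\<lambda>x. norm (frechet_derivative f (at (reversepath g x)) (vector_derivative (reversepath g) (at x))))
               has_integral L) {0..1}"
    by (rule has_integral_spike_finite[rotated 2, where S = "(\<lambda>x. 1 - x) ` S"]) (use S * in auto)
  then show ?thesis
    using assms by (simp add: has_length_def)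
qed

lemma has_length_join:
  assumes f: "\<And>x. f differentiable (at x)"
    and 1: "has_length f g1 L1" and 2: "has_length f g2 L2"
    and "pathfinish g1 = pathstart g2"
  shows "has_length f (g1 +++ g2) (L1 + L2)"
proof -
  obtain s1 s2
    where s1: "finite s1" "\<forall>x\<in>{0..1} - s1. g1 differentiable at x"
      and s2: "finite s2" "\<forall>x\<in>{0..1} - s2. g2 differentiable at x"
    using 1 2
    by (auto simp: has_length_def valid_path_def piecewise_C1_differentiable_on_def C1_differentiable_on_eq)
  define F where "F g = (\<lambda>t. norm (frechet_derivative f (at (g t)) (vector_derivative g (at t))))"
    for g :: "real \<Rightarrow> real^2"
  have F: "(F g1 has_integral L1) {0..1}" "(F g2 has_integral L2) {0..1}"
    using 1 2 by (simp_all add: has_length_def F_def)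
  have i1: "((\<lambda>x. 2 * F g1 (2*x)) has_integral L1) {0..1/2}"
   and i2: "((\<lambda>x. 2 * F g2 (2*x - 1)) has_integral L2) {1/2..1}"
    using has_integral_affinity01 [OF F(1), where m= 2 and c=0, THEN has_integral_cmul [where c=2]]
          has_integral_affinity01 [OF F(2), where m= 2 and c="-1", THEN has_integral_cmul [where c=2]]
    by (simp_all only: image_affinity_atLeastAtMost_div_diff, simp_all add: mult_ac)
  have scale: "norm (frechet_derivative f (at x) (2 *\<^sub>R v)) = 2 * norm (frechet_derivative f (at x) v)" for x v
    using linear_frechet_derivative[OF f, of x] by (simp add: linear_cmul)
  have g1: "F (g1 +++ g2) z = 2 * F g1 (2 * z)" if "0 \<le> z" "2 * z < 1" "2 * z \<notin> s1" for z
  proof -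
    have d: "(g1 has_vector_derivative vector_derivative g1 (at (2 * z))) (at (2 * z))"
      using s1 that by (auto simp: vector_derivative_works)
    have "(g1 \<circ> (\<lambda>x. 2 * x) has_vector_derivative 2 *\<^sub>R vector_derivative g1 (at (2 * z))) (at z)"
      by (rule vector_diff_chain_at) (auto intro!: derivative_eq_intros d)
    then have "(g1 +++ g2 has_vector_derivative 2 *\<^sub>R vector_derivative g1 (at (2 * z))) (at z)"
      by (rule has_vector_derivative_transform_within[where d = "\<bar>z - 1/2\<bar>"])
         (use that in \<open>auto simp: joinpaths_def dist_real_def\<close>)
    then have "vector_derivative (g1 +++ g2) (at z) = 2 *\<^sub>R vector_derivative g1 (at (2 * z))"
      by (rule vector_derivative_at)
    then show ?thesis
      using that by (simp add: F_def scale) (simp add: joinpaths_def)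
  qed
  have g2: "F (g1 +++ g2) z = 2 * F g2 (2 * z - 1)" if "1 < 2 * z" "z \<le> 1" "2 * z - 1 \<notin> s2" for z
  proof -
    have d: "(g2 has_vector_derivative vector_derivative g2 (at (2 * z - 1))) (at (2 * z - 1))"
      using s2 that by (auto simp: vector_derivative_works)
    have "(g2 \<circ> (\<lambda>x. 2 * x - 1) has_vector_derivative 2 *\<^sub>R vector_derivative g2 (at (2 * z - 1))) (at z)"
      by (rule vector_diff_chain_at) (auto intro!: derivative_eq_intros d)
    then have "(g1 +++ g2 has_vector_derivative 2 *\<^sub>R vector_derivative g2 (at (2 * z - 1))) (at z)"
      by (rule has_vector_derivative_transform_within[where d = "\<bar>z - 1/2\<bar>"])
         (use that in \<open>auto simp: joinpaths_def dist_real_def abs_if split: if_splits\<close>)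
    then have "vector_derivative (g1 +++ g2) (at z) = 2 *\<^sub>R vector_derivative g2 (at (2 * z - 1))"
      by (rule vector_derivative_at)
    then show ?thesis
      using that by (simp add: F_def scale) (simp add: joinpaths_def)
  qed
  have "(F (g1 +++ g2) has_integral L1) {0..1/2}"
  proof (rule has_integral_spike_finite [OF _ _ i1])
    show "finite (insert (1/2) ((*) 2 -` s1))"
      using s1 by (force intro: finite_vimageI [where h = "(*)2"] inj_onI)
  qed (auto simp: g1)
  moreover have "(F (g1 +++ g2) has_integral L2) {1/2..1}"
  proof (rule has_integral_spike_finite [OF _ _ i2])
    show "finite (insert (1/2) ((\<lambda>x. 2 * x - 1) -` s2))"
      using s2 by (force intro: finite_vimageI [where h = "\<lambda>x. 2*x-1"] inj_onI)
  qed (auto simp: g2)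
  ultimately have "(F (g1 +++ g2) has_integral (L1 + L2)) {0..1}"
    by (rule has_integral_combine [where c = "1/2", rotated 2]) auto
  then show ?thesis
    using assms by (simp add: has_length_def F_def valid_path_join)
qed

text \<open>
  Segments show that the set of lengths between two points is nonempty, and bound the induced
  distance from above by a local bound on the derivative.
\<close>

lemma has_length_linepath:
  assumes f: "smooth_on UNIV f"
  obtains L where "has_length f (linepath p q) L"
    "\<And>B. (\<And>z. z \<in> closed_segment p q \<Longrightarrow> norm (frechet_derivative f (at z) (q - p)) \<le> B) \<Longrightarrow> L \<le> B"
proof -
  let ?F = "\<lambda>t. norm (frechet_derivative f (at (linepath p q t)) (q - p))"
  have "continuous_on {0..1} ?F"
    by (intro continuous_on_norm continuous_on_compose2[OF smooth_on_continuous
          [OF smooth_on_directional_derivative[OF f]]] continuous_on_linepath) auto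
  then obtain L where L: "(?F has_integral L) {0..1}"
    using integrable_continuous_interval by blast
  show thesis
  proof
    show "has_length f (linepath p q) L"
      using L by (simp add: has_length_def)
    fix B
    assume B: "\<And>z. z \<in> closed_segment p q \<Longrightarrow> norm (frechet_derivative f (at z) (q - p)) \<le> B"
    have "((\<lambda>t. B) has_integral B) {0..1::real}"
      using has_integral_const_real[of B 0 1] by simp
    from L this show "L \<le> B"
      by (rule has_integral_le) (use B linepath_in_path in blast)
  qed
qed

text \<open>
  If the immersion does not shrink tangent vectors, then the speed measured on the surface dominates
  the Euclidean speed in the parameter plane, whose integral dominates the displacement.
\<close>

lemma dist_le_length:
  assumes expand: "\<And>p v. norm v \<le> norm (frechet_derivative f (at p) v)"
    and g: "has_length f g L"
  shows "dist (pathstart g) (pathfinish g) \<le> L"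
proof -
  obtain S where S: "continuous_on {0..1} g" "finite S" "\<forall>x\<in>{0..1} - S. g differentiable at x"
    using g by (auto simp: has_length_def valid_path_def piecewise_C1_differentiable_on_def C1_differentiable_on_eq)
  have "((\<lambda>t. vector_derivative g (at t)) has_integral (g 1 - g 0)) {0..1}"
    by (rule fundamental_theorem_of_calculus_interior_strong[OF S(2)])
       (use S in \<open>auto simp: vector_derivative_works\<close>)
  moreover have "((\<lambda>t. norm (frechet_derivative f (at (g t)) (vector_derivative g (at t)))) has_integral L) {0..1}"
    using g by (simp add: has_length_def)
  ultimately have "norm (g 1 - g 0) \<le> L"
    using integral_norm_bound_integral[OF has_integral_integrable has_integral_integrable] expand
    by (metis (no_types, lifting) integral_unique)
  then show ?thesis
    by (simp add: pathstart_def pathfinish_def dist_norm norm_minus_commute)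
qed

lemma induced_dist_le:
  assumes "has_length f \<gamma> L" "pathstart \<gamma> = p" "pathfinish \<gamma> = q"
  shows "induced_dist f p q \<le> L"
  unfolding induced_dist_eq_Inf_has_length
  by (rule cInf_lower) (use assms has_length_nonneg in \<open>auto intro!: bdd_belowI\<close>)

lemma induced_dist_greatest:
  assumes "smooth_on UNIV f"
    and "\<And>\<gamma> L. has_length f \<gamma> L \<Longrightarrow> pathstart \<gamma> = p \<Longrightarrow> pathfinish \<gamma> = q \<Longrightarrow> z \<le> L"
  shows "z \<le> induced_dist f p q"
  unfolding induced_dist_eq_Inf_has_length
proof (rule cInf_greatest)
  obtain L where "has_length f (linepath p q) L"
    using has_length_linepath assms(1) by blast
  then show "{L. \<exists>\<gamma>. has_length f \<gamma> L \<and> pathstart \<gamma> = p \<and> pathfinish \<gamma> = q} \<noteq> {}"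
    using pathstart_linepath pathfinish_linepath by blast
qed (use assms(2) in blast)

lemma Metric_space_induced_dist:
  assumes f: "smooth_on UNIV f" and expand: "\<And>p v. norm v \<le> norm (frechet_derivative f (at p) v)"
  shows "Metric_space UNIV (induced_dist f)"
proof -
  have diff: "\<And>x. f differentiable (at x)"
    using f smooth_on_differentiable by blast
  have nonneg: "0 \<le> induced_dist f p q" for p q
    using f has_length_nonneg by (rule induced_dist_greatest)
  have sym: "induced_dist f p q \<le> induced_dist f q p" for p q
    using f by (rule induced_dist_greatest)
      (rule induced_dist_le, rule has_length_reversepath, rule diff, simp_all)
  have lower: "dist p q \<le> induced_dist f p q" for p q
    using f by (rule induced_dist_greatest) (use dist_le_length[OF expand] in blast)
  have refl: "induced_dist f p p = 0" for p
  proof -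
    obtain L where "has_length f (linepath p p) L"
      and L: "\<And>B. (\<And>z. z \<in> closed_segment p p \<Longrightarrow> norm (frechet_derivative f (at z) (p - p)) \<le> B) \<Longrightarrow> L \<le> B"
      using has_length_linepath[OF f] by blast
    moreover have "L \<le> 0"
      by (rule L) (simp add: linear_0[OF linear_frechet_derivative[OF diff]])
    ultimately have "induced_dist f p p \<le> 0"
      using induced_dist_le[of f "linepath p p" L p p] by simp
    then show ?thesis
      using nonneg by (simp add: order_antisym)
  qed
  have triangle: "induced_dist f p r \<le> induced_dist f p q + induced_dist f q r" for p q r
  proof -
    have "induced_dist f p r - L \<le> induced_dist f q r"
      if L: "has_length f \<gamma> L" "pathstart \<gamma> = p" "pathfinish \<gamma> = q" for \<gamma> L
    proof (rule induced_dist_greatest[OF f])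
      fix \<delta> M
      assume "has_length f \<delta> M" "pathstart \<delta> = q" "pathfinish \<delta> = r"
      then have "induced_dist f p r \<le> L + M"
        using L by (intro induced_dist_le[of f "\<gamma> +++ \<delta>"] has_length_join diff) auto
      then show "induced_dist f p r - L \<le> M"
        by simp
    qed
    then have "induced_dist f p r - induced_dist f q r \<le> induced_dist f p q"
      by (intro induced_dist_greatest[OF f]) (force simp: algebra_simps)
    then show ?thesis
      by simp
  qed
  show ?thesis
  proof
    show "induced_dist f p q = 0 \<longleftrightarrow> p = q" for p q
      using lower[of p q] refl by auto
  qed (use nonneg sym triangle in \<open>auto intro: order_antisym\<close>)
qed

lemma frechet_derivative_bounded_on_compact:
  fixes f :: "'a::euclidean_space \<Rightarrow> 'b::real_normed_vector"
  assumes f: "smooth_on UNIV f" and "compact K"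
  obtains B where "B > 0" "\<And>z v. z \<in> K \<Longrightarrow> norm (frechet_derivative f (at z) v) \<le> B * norm v"
proof -
  have "\<exists>c. \<forall>z\<in>K. norm (frechet_derivative f (at z) b) \<le> c" for b
  proof -
    have "bounded ((\<lambda>z. frechet_derivative f (at z) b) ` K)"
      using smooth_on_continuous[OF smooth_on_directional_derivative[OF f]] \<open>compact K\<close>
      by (meson compact_continuous_image compact_imp_bounded continuous_on_subset subset_UNIV)
    then show ?thesis
      by (auto simp: bounded_iff)
  qed
  then obtain c where c: "\<And>b z. z \<in> K \<Longrightarrow> norm (frechet_derivative f (at z) b) \<le> c b"
    by metis
  define B where "B = 1 + (\<Sum>b\<in>Basis. \<bar>c b\<bar>)"
  show thesis
  proof
    show "B > 0"
      unfolding B_def by (smt (verit) abs_ge_zero sum_nonneg)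
    fix z v
    assume "z \<in> K"
    interpret linear "frechet_derivative f (at z)"
      by (rule linear_frechet_derivative) (use f smooth_on_differentiable in blast)
    have "norm (frechet_derivative f (at z) v) = norm (frechet_derivative f (at z) (\<Sum>b\<in>Basis. (v \<bullet> b) *\<^sub>R b))"
      by (simp add: euclidean_representation)
    also have "\<dots> = norm (\<Sum>b\<in>Basis. (v \<bullet> b) *\<^sub>R frechet_derivative f (at z) b)"
      by (simp add: sum scale)
    also have "\<dots> \<le> (\<Sum>b\<in>Basis. norm v * \<bar>c b\<bar>)"
    proof (rule sum_norm_le)
      fix b :: 'a
      assume "b \<in> Basis"
      then show "norm ((v \<bullet> b) *\<^sub>R frechet_derivative f (at z) b) \<le> norm v * \<bar>c b\<bar>"
        using c[OF \<open>z \<in> K\<close>, of b] Basis_le_norm[of b v] by (simp add: mult_mono)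
    qed
    also have "\<dots> \<le> B * norm v"
      by (simp add: B_def sum_distrib_left[symmetric] algebra_simps)
    finally show "norm (frechet_derivative f (at z) v) \<le> B * norm v" .
  qed
qed

text \<open>
  The induced distance dominates the Euclidean one, so a Cauchy sequence converges in the parameter
  plane.  Near the limit the derivative is bounded, so segments show that the induced distance is at
  most a multiple of the Euclidean one there, and the sequence converges for it as well.
\<close>

lemma complete_surface_if_expanding:
  assumes f: "smooth_on UNIV f" and expand: "\<And>p v. norm v \<le> norm (frechet_derivative f (at p) v)"
  shows "complete_surface f"
proof -
  interpret Metric_space UNIV "induced_dist f"
    using assms by (rule Metric_space_induced_dist)
  have lower: "dist p q \<le> induced_dist f p q" for p q
    using f by (rule induced_dist_greatest) (use dist_le_length[OF expand] in blast)
  show ?thesis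
    unfolding complete_surface_def mcomplete_def
  proof (intro allI impI)
    fix \<sigma>
    assume "MCauchy \<sigma>"
    then have "Cauchy \<sigma>"
      unfolding MCauchy_def Cauchy_def by (meson lower order_le_less_trans)
    then obtain x where x: "\<sigma> \<longlonglongrightarrow> x"
      using Cauchy_convergent_iff convergent_def by blast
    obtain B where "B > 0"
      and B: "\<And>z v. z \<in> cball x 1 \<Longrightarrow> norm (frechet_derivative f (at z) v) \<le> B * norm v"
      using frechet_derivative_bounded_on_compact[OF f compact_cball] by blast
    have upper: "induced_dist f p x \<le> B * dist p x" if "p \<in> cball x 1" for p
    proof -
      obtain L where L: "has_length f (linepath p x) L"
        and le: "\<And>C. (\<And>z. z \<in> closed_segment p x \<Longrightarrow> norm (frechet_derivative f (at z) (x - p)) \<le> C) \<Longrightarrow> L \<le> C"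
        using has_length_linepath[OF f] by blast
      have "closed_segment p x \<subseteq> cball x 1"
        using that by (intro closed_segment_subset) auto
      then have "L \<le> B * norm (x - p)"
        using B by (intro le) auto
      then show ?thesis
        using induced_dist_le[OF L, of p x] by (simp add: dist_norm norm_minus_commute)
    qed
    have "\<forall>\<^sub>F n in sequentially. induced_dist f (\<sigma> n) x < \<epsilon>" if "\<epsilon> > 0" for \<epsilon>
    proof -
      have "\<forall>\<^sub>F n in sequentially. dist (\<sigma> n) x < min 1 (\<epsilon> / B)"
        using x that \<open>B > 0\<close> by (intro tendstoD) auto
      then show ?thesis
      proof eventually_elim
        case (elim n)
        then have "induced_dist f (\<sigma> n) x \<le> B * dist (\<sigma> n) x"
          by (intro upper) (simp add: dist_commute)
        also have "\<dots> < \<epsilon>"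
          using elim \<open>B > 0\<close> by (simp add: field_simps)
        finally show ?case .
      qed
    qed
    then show "\<exists>x. limitin mtopology \<sigma> x sequentially"
      by (auto simp: limitin_metric)
  qed
qed

section \<open>Symmetry of mixed second derivatives\<close>

lemma line_has_derivative:
  assumes "g differentiable (at (p + t *\<^sub>R v))"
  shows "((\<lambda>t. g (p + t *\<^sub>R v)) has_vector_derivative frechet_derivative g (at (p + t *\<^sub>R v)) v) (at t)"
proof -
  have "(g has_derivative frechet_derivative g (at (p + t *\<^sub>R v))) (at (p + t *\<^sub>R v))"
    using assms frechet_derivative_works by blast
  then have "(g \<circ> (\<lambda>t. p + t *\<^sub>R v) has_derivative
      frechet_derivative g (at (p + t *\<^sub>R v)) \<circ> (\<lambda>h. h *\<^sub>R v)) (at t)"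
    by (intro diff_chain_at) (auto intro!: derivative_eq_intros)
  then show ?thesis
    using linear_cmul[OF linear_frechet_derivative[OF assms]]
    by (simp add: has_vector_derivative_def o_def)
qed

text \<open>
  The mean value theorem, used once in direction \<open>u\<close> and once in direction \<open>v\<close>, turns
  a second difference into a mixed second derivative.  It holds for real functions only, hence the
  inner product with a fixed \<open>w\<close>.
\<close>

lemma second_difference_mean_value:
  fixes g :: "'a::real_normed_vector \<Rightarrow> 'b::real_inner"
  assumes g: "smooth_on S g" and "h > 0"
    and in_S: "\<And>s t. s \<in> {0..h} \<Longrightarrow> t \<in> {0..h} \<Longrightarrow> p + s *\<^sub>R u + t *\<^sub>R v \<in> S"
  obtains s t where "s \<in> {0..h}" "t \<in> {0..h}"
    "(g (p + h *\<^sub>R u + h *\<^sub>R v) - g (p + h *\<^sub>R u) - g (p + h *\<^sub>R v) + g p) \<bullet> w =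
       h\<^sup>2 * (frechet_derivative (\<lambda>q. frechet_derivative g (at q) u) (at (p + s *\<^sub>R u + t *\<^sub>R v)) v \<bullet> w)"
proof -
  let ?gu = "\<lambda>q. frechet_derivative g (at q) u"
  let ?\<phi> = "\<lambda>s. (g ((p + h *\<^sub>R v) + s *\<^sub>R u) - g (p + s *\<^sub>R u)) \<bullet> w"
  have diff: "g differentiable (at q)" "?gu differentiable (at q)" if "q \<in> S" for q
    using smooth_on_differentiable[OF g] smooth_on_differentiable[OF smooth_on_directional_derivative[OF g]] that
    by auto
  have der: "(?\<phi> has_derivative (\<lambda>x. x * ((?gu ((p + h *\<^sub>R v) + s *\<^sub>R u) - ?gu (p + s *\<^sub>R u)) \<bullet> w))) (at s)"
    if "s \<in> {0..h}" for s
  proof -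
    have "(p + h *\<^sub>R v) + s *\<^sub>R u \<in> S" "p + s *\<^sub>R u \<in> S"
      using in_S[of s h] in_S[of s 0] that \<open>h > 0\<close> by (auto simp: algebra_simps)
    then have "((\<lambda>s. g ((p + h *\<^sub>R v) + s *\<^sub>R u)) has_vector_derivative ?gu ((p + h *\<^sub>R v) + s *\<^sub>R u)) (at s)"
      "((\<lambda>s. g (p + s *\<^sub>R u)) has_vector_derivative ?gu (p + s *\<^sub>R u)) (at s)"
      by (auto intro!: line_has_derivative diff)
    from has_vector_derivative_diff[OF this]
    show ?thesis
      by (auto simp: has_vector_derivative_def dest: has_derivative_inner_left[of _ _ _ w])
  qed
  obtain s where s: "0 < s" "s < h"
    "?\<phi> h - ?\<phi> 0 = (h - 0) * ((?gu ((p + h *\<^sub>R v) + s *\<^sub>R u) - ?gu (p + s *\<^sub>R u)) \<bullet> w)"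
    using mvt_simple[OF \<open>h > 0\<close> has_derivative_at_withinI[OF der]] by auto
  let ?\<psi> = "\<lambda>t. ?gu ((p + s *\<^sub>R u) + t *\<^sub>R v) \<bullet> w"
  have der2: "(?\<psi> has_derivative
      (\<lambda>x. x * (frechet_derivative ?gu (at ((p + s *\<^sub>R u) + t *\<^sub>R v)) v \<bullet> w))) (at t)"
    if "t \<in> {0..h}" for t
  proof -
    have "(p + s *\<^sub>R u) + t *\<^sub>R v \<in> S"
      using in_S[of s t] that s by auto
    then have "((\<lambda>t. ?gu ((p + s *\<^sub>R u) + t *\<^sub>R v)) has_vector_derivative
        frechet_derivative ?gu (at ((p + s *\<^sub>R u) + t *\<^sub>R v)) v) (at t)"
      by (intro line_has_derivative diff)
    then show ?thesis
      by (auto simp: has_vector_derivative_def dest: has_derivative_inner_left[of _ _ _ w])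
  qed
  obtain t where t: "0 < t" "t < h"
    "?\<psi> h - ?\<psi> 0 = (h - 0) * (frechet_derivative ?gu (at ((p + s *\<^sub>R u) + t *\<^sub>R v)) v \<bullet> w)"
    using mvt_simple[OF \<open>h > 0\<close> has_derivative_at_withinI[OF der2]] by auto
  show thesis
  proof (rule that[of s t])
    have "(g (p + h *\<^sub>R u + h *\<^sub>R v) - g (p + h *\<^sub>R u) - g (p + h *\<^sub>R v) + g p) \<bullet> w = ?\<phi> h - ?\<phi> 0"
      by (simp add: algebra_simps)
    also have "\<dots> = h * (?\<psi> h - ?\<psi> 0)"
      using s(3) by (simp add: algebra_simps)
    finally show "(g (p + h *\<^sub>R u + h *\<^sub>R v) - g (p + h *\<^sub>R u) - g (p + h *\<^sub>R v) + g p) \<bullet> w =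
       h\<^sup>2 * (frechet_derivative ?gu (at (p + s *\<^sub>R u + t *\<^sub>R v)) v \<bullet> w)"
      using t(3) by (simp add: power2_eq_square)
  qed (use s t in auto)
qed

text \<open>
  The second difference does not change when \<open>u\<close> and \<open>v\<close> are exchanged.  So on
  arbitrarily small parallelograms at \<open>p\<close> the two mixed derivatives agree, although at
  different points; continuity carries the equality to \<open>p\<close>.
\<close>

lemma second_derivative_symmetric:
  fixes g :: "'a::real_normed_vector \<Rightarrow> 'b::real_inner"
  assumes g: "smooth_on S g" and "open S" "p \<in> S"
  shows "frechet_derivative (\<lambda>q. frechet_derivative g (at q) u) (at p) v =
         frechet_derivative (\<lambda>q. frechet_derivative g (at q) v) (at p) u"
proof -
  define H where "H u v q = frechet_derivative (\<lambda>q. frechet_derivative g (at q) u) (at q) v" for u v q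
  have "H u v p \<bullet> w = H v u p \<bullet> w" for w
  proof (rule ccontr)
    let ?A = "\<lambda>q. H u v q \<bullet> w" and ?B = "\<lambda>q. H v u q \<bullet> w"
    assume "?A p \<noteq> ?B p"
    define e where "e = \<bar>?A p - ?B p\<bar> / 2"
    have "e > 0"
      using \<open>?A p \<noteq> ?B p\<close> by (simp add: e_def)
    have cont: "continuous_on S (\<lambda>q. H a b q \<bullet> w)" for a b
      unfolding H_def
      by (intro continuous_on_inner continuous_on_const smooth_on_continuous
          smooth_on_directional_derivative g)
    have "\<forall>\<^sub>F q in nhds p. dist (H a b q \<bullet> w) (H a b p \<bullet> w) < e" for a b
    proof -
      have "isCont (\<lambda>q. H a b q \<bullet> w) p"
        using cont \<open>open S\<close> \<open>p \<in> S\<close> by (simp add: continuous_on_eq_continuous_at)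
      then have "filterlim (\<lambda>q. H a b q \<bullet> w) (nhds (H a b p \<bullet> w)) (nhds p)"
        unfolding isCont_def by (rule tendsto_at_iff_tendsto_nhds[where g = "\<lambda>q. H a b q \<bullet> w", THEN iffD1])
      then show ?thesis
        using \<open>e > 0\<close> by (rule tendstoD)
    qed
    then have "\<forall>\<^sub>F q in nhds p. q \<in> S \<and> dist (?A q) (?A p) < e \<and> dist (?B q) (?B p) < e"
      using eventually_nhds_in_open[OF \<open>open S\<close> \<open>p \<in> S\<close>] by (intro eventually_conj) auto
    then obtain d where "d > 0"
      and d: "\<And>q. dist q p < d \<Longrightarrow> q \<in> S \<and> dist (?A q) (?A p) < e \<and> dist (?B q) (?B p) < e"
      unfolding eventually_nhds_metric by blast
    define h where "h = d / (norm u + norm v + 1)"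
    have "0 < norm u + norm v + 1"
      by (smt (verit) norm_ge_zero)
    then have "h > 0" and h: "h * (norm u + norm v + 1) = d"
      using \<open>d > 0\<close> by (simp_all add: h_def)
    have near: "dist (p + s *\<^sub>R u + t *\<^sub>R v) p < d" if "s \<in> {0..h}" "t \<in> {0..h}" for s t
    proof -
      have "dist (p + s *\<^sub>R u + t *\<^sub>R v) p = norm (s *\<^sub>R u + t *\<^sub>R v)"
        by (simp add: dist_norm algebra_simps)
      also have "\<dots> \<le> norm (s *\<^sub>R u) + norm (t *\<^sub>R v)"
        by (rule norm_triangle_ineq)
      also have "\<dots> \<le> h * norm u + h * norm v"
        using that by (intro add_mono) (auto intro: mult_right_mono)
      also have "\<dots> < d"
        using h \<open>h > 0\<close> by (simp add: algebra_simps)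
      finally show ?thesis .
    qed
    obtain s t where 1: "s \<in> {0..h}" "t \<in> {0..h}"
      "(g (p + h *\<^sub>R u + h *\<^sub>R v) - g (p + h *\<^sub>R u) - g (p + h *\<^sub>R v) + g p) \<bullet> w =
        h\<^sup>2 * ?A (p + s *\<^sub>R u + t *\<^sub>R v)"
      using second_difference_mean_value[OF g \<open>h > 0\<close> d[OF near, THEN conjunct1], where w = w]
      unfolding H_def by metis
    have in_S: "p + s *\<^sub>R v + t *\<^sub>R u \<in> S" if "s \<in> {0..h}" "t \<in> {0..h}" for s t
      using near[OF that(2,1)] d by (simp add: algebra_simps)
    obtain s' t' where 2: "s' \<in> {0..h}" "t' \<in> {0..h}"
      "(g (p + h *\<^sub>R v + h *\<^sub>R u) - g (p + h *\<^sub>R v) - g (p + h *\<^sub>R u) + g p) \<bullet> w =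
        h\<^sup>2 * ?B (p + s' *\<^sub>R v + t' *\<^sub>R u)"
      using second_difference_mean_value[OF g \<open>h > 0\<close> in_S, where w = w] unfolding H_def by metis
    have "h\<^sup>2 * ?A (p + s *\<^sub>R u + t *\<^sub>R v) = h\<^sup>2 * ?B (p + t' *\<^sub>R u + s' *\<^sub>R v)"
      using 1(3) 2(3) by (simp add: algebra_simps)
    then have "?A (p + s *\<^sub>R u + t *\<^sub>R v) = ?B (p + t' *\<^sub>R u + s' *\<^sub>R v)"
      using \<open>h > 0\<close> by simp
    moreover have "dist (?A (p + s *\<^sub>R u + t *\<^sub>R v)) (?A p) < e"
      "dist (?B (p + t' *\<^sub>R u + s' *\<^sub>R v)) (?B p) < e"
      using d[OF near[OF 1(1,2)]] d[OF near[OF 2(2,1)]] by simp_all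
    ultimately show False
      unfolding e_def dist_real_def by argo
  qed
  then have "(H u v p - H v u p) \<bullet> (H u v p - H v u p) = 0"
    by (simp add: inner_diff_left)
  then show ?thesis
    by (simp add: H_def)
qed

section \<open>The graph of the difference of two fourth powers\<close>

definition quartic_saddle :: "real^2 \<Rightarrow> real^3" where
  "quartic_saddle p = p$1 *\<^sub>R axis 1 1 + p$2 *\<^sub>R axis 2 1 + ((p$1)^4 - (p$2)^4) *\<^sub>R axis 3 1"

lemma quartic_saddle_derivative:
  "frechet_derivative quartic_saddle (at p) =
     (\<lambda>u. u$1 *\<^sub>R axis 1 1 + u$2 *\<^sub>R axis 2 1 + (4 * (p$1)^3 * u$1 - 4 * (p$2)^3 * u$2) *\<^sub>R axis 3 1)"
  unfolding quartic_saddle_def[abs_def]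
  by (rule frechet_derivative_at[symmetric])
     (auto intro!: derivative_eq_intros bounded_linear.has_derivative[OF bounded_linear_vec_nth] simp: fun_eq_iff)

lemma quartic_saddle_second_derivative:
  "frechet_derivative (\<lambda>q. frechet_derivative quartic_saddle (at q) u) (at p) =
     (\<lambda>v. (12 * (p$1)^2 * u$1 * v$1 - 12 * (p$2)^2 * u$2 * v$2) *\<^sub>R axis 3 1)"
  unfolding quartic_saddle_derivative
  by (rule frechet_derivative_at[symmetric])
     (auto intro!: derivative_eq_intros bounded_linear.has_derivative[OF bounded_linear_vec_nth] simp: fun_eq_iff)

lemma smooth_quartic_saddle: "smooth_on UNIV quartic_saddle"
  unfolding quartic_saddle_def[abs_def]
proof (rule smooth_on_polynomial_function)
  have "real_polynomial_function (\<lambda>p::real^2. p $ i)" for i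
    by (intro real_polynomial_function.intros(1) bounded_linear_vec_nth)
  then show "polynomial_function (\<lambda>p::real^2. p$1 *\<^sub>R axis 1 1 + p$2 *\<^sub>R axis 2 1 + ((p$1)^4 - (p$2)^4) *\<^sub>R axis 3 1 :: real^3)"
    by (intro polynomial_function_add polynomial_function_mult polynomial_function_const
        real_polynomial_function_diff real_polynomial_function_power) 
      (auto intro!: real_polynomial_function_diff real_polynomial_function_power
          simp flip: real_polynomial_function_eq)
qed

lemma quartic_saddle_expanding:
  "norm v \<le> norm (frechet_derivative quartic_saddle (at p) v)"
  unfolding quartic_saddle_derivative norm_eq_sqrt_inner
  by (simp add: inner_vec_def sum_2 sum_3 axis_def)

lemma quartic_saddle_first_form:
  "first_form quartic_saddle p u v =
     u$1 * v$1 + u$2 * v$2 +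
     (4 * (p$1)^3 * u$1 - 4 * (p$2)^3 * u$2) * (4 * (p$1)^3 * v$1 - 4 * (p$2)^3 * v$2)"
  unfolding first_form_def quartic_saddle_derivative
  by (simp add: inner_vec_def sum_3 axis_def)

text \<open>
  The factor \<open>c\<close> is the third component of the unit normal, positive for every graph.  The sign
  of the curvature and the zeros of the second fundamental form depend only on its being positive.
\<close>

lemma quartic_saddle_second_form:
  obtains c where "c > 0"
    "\<And>u v. second_form quartic_saddle p u v = (12 * (p$1)^2 * u$1 * v$1 - 12 * (p$2)^2 * u$2 * v$2) * c"
proof
  let ?N = "cross3 (frechet_derivative quartic_saddle (at p) (axis 1 1))
                   (frechet_derivative quartic_saddle (at p) (axis 2 1))"
  have N: "?N $ 3 = 1"
    by (simp add: quartic_saddle_derivative cross3_def axis_def)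
  then have "?N \<noteq> 0"
    by (metis zero_index zero_neq_one)
  then show "0 < inverse (norm ?N)"
    by simp
  show "second_form quartic_saddle p u v =
      (12 * (p$1)^2 * u$1 * v$1 - 12 * (p$2)^2 * u$2 * v$2) * inverse (norm ?N)" for u v
    using N unfolding second_form_def unit_normal_def quartic_saddle_second_derivative
    by (simp add: sgn_div_norm inner_axis' divide_inverse)
qed

lemma quartic_saddle_curvature_nonpos: "gauss_curvature quartic_saddle p \<le> 0"
proof -
  obtain c where c: "c > 0"
    "\<And>u v. second_form quartic_saddle p u v = (12 * (p$1)^2 * u$1 * v$1 - 12 * (p$2)^2 * u$2 * v$2) * c"
    using quartic_saddle_second_form by blast
  \<comment> \<open>It is a negative multiple of the square of the product of the coordinates.\<close>
  have "det (\<chi> i j. second_form quartic_saddle p (axis i 1) (axis j 1)) \<le> 0"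
    using c(1) by (simp add: det_2 c(2) axis_def)
  \<comment> \<open>For a graph it is 1 plus the square of the length of the gradient.\<close>
  moreover have "det (\<chi> i j. first_form quartic_saddle p (axis i 1) (axis j 1)) \<ge> 0"
    by (simp add: det_2 quartic_saddle_first_form axis_def algebra_simps)
  ultimately show ?thesis
    unfolding gauss_curvature_def by (rule divide_nonpos_nonneg)
qed

lemma saddle_plane_quartic_saddle: "saddle_plane quartic_saddle"
proof -
  have "inj (frechet_derivative quartic_saddle (at p))" for p
  proof -
    have "linear (frechet_derivative quartic_saddle (at p))"
      by (intro linear_frechet_derivative smooth_on_differentiable[OF smooth_quartic_saddle] UNIV_I)
    then show ?thesis
      using quartic_saddle_expanding
      by (metis linear_injective_0 norm_le_zero_iff norm_zero)
  qed
  then show ?thesis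
    unfolding saddle_plane_def immersed_plane_def
    using smooth_quartic_saddle quartic_saddle_expanding quartic_saddle_curvature_nonpos
    by (simp add: complete_surface_if_expanding)
qed

section \<open>The circles are asymptotic curves\<close>

text \<open>
  Such motions, with arbitrary amplitudes \<open>a\<close> and \<open>b\<close>, form a class closed under
  differentiation.
\<close>

lemma smooth_on_harmonic_motion:
  fixes a b :: "'a::real_normed_vector"
  shows "smooth_on UNIV (\<lambda>t. cos (\<omega> * t) *\<^sub>R a + sin (\<omega> * t) *\<^sub>R b)"
proof (rule smooth_on_coinduct[where P = "\<lambda>f. \<exists>a b. f = (\<lambda>t. cos (\<omega> * t) *\<^sub>R a + sin (\<omega> * t) *\<^sub>R b)"])
  fix f :: "real \<Rightarrow> 'a"
  assume "\<exists>a b. f = (\<lambda>t. cos (\<omega> * t) *\<^sub>R a + sin (\<omega> * t) *\<^sub>R b)"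
  then obtain a b where f: "f = (\<lambda>t. cos (\<omega> * t) *\<^sub>R a + sin (\<omega> * t) *\<^sub>R b)" by blast
  have der: "(f has_derivative (\<lambda>v. cos (\<omega> * t) *\<^sub>R (v * \<omega>) *\<^sub>R b + sin (\<omega> * t) *\<^sub>R (- (v * \<omega>)) *\<^sub>R a)) (at t)" for t
    unfolding f by (auto intro!: derivative_eq_intros simp: fun_eq_iff algebra_simps)
  then show "f differentiable (at t)" for t
    using differentiableI by blast
  show "\<exists>a b. (\<lambda>t. frechet_derivative f (at t) v) = (\<lambda>t. cos (\<omega> * t) *\<^sub>R a + sin (\<omega> * t) *\<^sub>R b)" for v
    unfolding frechet_derivative_at[OF der, symmetric] by (intro exI) (rule refl)
qed blast

definition circle :: "real \<Rightarrow> real \<Rightarrow> real^2" where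
  "circle r t = cos (2 * pi * t) *\<^sub>R (r *\<^sub>R axis 1 1) + sin (2 * pi * t) *\<^sub>R (r *\<^sub>R axis 2 1)"

lemma circle_nth: "circle r t $ 1 = r * cos (2 * pi * t)" "circle r t $ 2 = r * sin (2 * pi * t)"
  by (simp_all add: circle_def axis_def)

lemma circle_vector_derivative:
  "vector_derivative (circle r) (at t) =
     (2 * pi) *\<^sub>R (cos (2 * pi * t) *\<^sub>R (r *\<^sub>R axis 2 1) - sin (2 * pi * t) *\<^sub>R (r *\<^sub>R axis 1 1))"
  unfolding circle_def[abs_def]
  by (rule vector_derivative_at)
     (auto intro!: derivative_eq_intros simp: has_vector_derivative_def fun_eq_iff algebra_simps)

lemma circle_vector_derivative_nth:
  "vector_derivative (circle r) (at t) $ 1 = - (2 * pi * r * sin (2 * pi * t))"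
  "vector_derivative (circle r) (at t) $ 2 = 2 * pi * r * cos (2 * pi * t)"
  by (simp_all add: circle_vector_derivative axis_def)

lemma range_circle:
  assumes "r \<ge> 0"
  shows "range (circle r) = sphere 0 r"
proof (intro set_eqI iffI)
  fix p
  assume "p \<in> range (circle r)"
  then obtain t where t: "p = circle r t" by blast
  have "p \<bullet> p = r\<^sup>2 * ((cos (2 * pi * t))\<^sup>2 + (sin (2 * pi * t))\<^sup>2)"
    unfolding inner_vec_def sum_2 t circle_nth inner_real_def by algebra
  then show "p \<in> sphere 0 r"
    using assms by (simp add: norm_eq_sqrt_inner)
next
  fix p :: "real^2"
  assume p: "p \<in> sphere 0 r"
  then have sq: "(p$1)\<^sup>2 + (p$2)\<^sup>2 = r\<^sup>2"
    by (auto simp: norm_eq_sqrt_inner inner_vec_def sum_2 power2_eq_square)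
  show "p \<in> range (circle r)"
  proof (cases "r = 0")
    case True
    then have "p = circle r 0"
      using p by (simp add: circle_def)
    then show ?thesis by blast
  next
    case False
    then have "(p$1 / r)\<^sup>2 + (p$2 / r)\<^sup>2 = 1"
      using sq by (simp add: power_divide flip: add_divide_distrib)
    then obtain t where "p$1 / r = cos t" "p$2 / r = sin t"
      using sincos_total_2pi by blast
    then have "p = circle r (t / (2 * pi))"
      using False by (simp add: vec_eq_iff forall_2 circle_nth field_simps)
    then show ?thesis by blast
  qed
qed

lemma circle_inj:
  assumes "r > 0"
  shows "inj_on (circle r) {0..<1}"
proof (rule inj_onI)
  fix s t :: real
  assume st: "s \<in> {0..<1}" "t \<in> {0..<1}" and eq: "circle r s = circle r t"
  then have "cos (2 * pi * s) = cos (2 * pi * t)" "sin (2 * pi * s) = sin (2 * pi * t)"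
    using assms circle_nth[of r s] circle_nth[of r t] by auto
  then obtain n :: int where "2 * pi * s = 2 * pi * t + 2 * pi * n"
    using sin_cos_eq_iff by (metis (no_types, lifting))
  then have "2 * pi * s = 2 * pi * (t + n)"
    by (simp add: algebra_simps)
  then have "s = t + n"
    by simp
  moreover from this have "n = 0"
    using st by simp
  ultimately show "s = t"
    by simp
qed

text \<open>
  At the point \<open>(x, y)\<close> of a circle about the origin the tangent is proportional to
  \<open>(-y, x)\<close>, and the second fundamental form takes there a multiple of
  \<open>x\<^sup>2 y\<^sup>2 - y\<^sup>2 x\<^sup>2\<close>.
\<close>

lemma closed_asymptotic_circle:
  assumes "r > 0"
  shows "closed_asymptotic_curve quartic_saddle (circle r)"
  unfolding closed_asymptotic_curve_def
proof (intro conjI allI)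
  show "smooth_on UNIV (circle r)"
    unfolding circle_def[abs_def] by (rule smooth_on_harmonic_motion)
  show "circle r (t + 1) = circle r t" for t
    by (simp add: circle_def distrib_left)
  show "inj_on (circle r) {0..<1}"
    using assms by (rule circle_inj)
  show "vector_derivative (circle r) (at t) \<noteq> 0" for t
  proof
    assume "vector_derivative (circle r) (at t) = 0"
    then have "vector_derivative (circle r) (at t) $ 1 = 0" "vector_derivative (circle r) (at t) $ 2 = 0"
      by simp_all
    then have "cos (2 * pi * t) = 0" "sin (2 * pi * t) = 0"
      using assms by (simp_all add: circle_vector_derivative_nth)
    then show False
      using sin_cos_squared_add[of "2 * pi * t"] by simp
  qed
  show "second_form quartic_saddle (circle r t)
      (vector_derivative (circle r) (at t)) (vector_derivative (circle r) (at t)) = 0" for t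
  proof -
    obtain c where "c > 0" and c: "\<And>u v. second_form quartic_saddle (circle r t) u v =
        (12 * (circle r t$1)^2 * u$1 * v$1 - 12 * (circle r t$2)^2 * u$2 * v$2) * c"
      by (rule quartic_saddle_second_form[of "circle r t"]) (rule that)
    show ?thesis
      unfolding c circle_vector_derivative_nth circle_nth by (simp add: power2_eq_square)
  qed
qed

lemma inside_circle: "r \<ge> 0 \<Longrightarrow> inside (range (circle r)) = ball 0 r"
  using inside_frontier_eq_interior[OF bounded_cball convex_cball, of "0 :: real^2" r]
  by (simp add: range_circle)

section \<open>The discs are not planar\<close>

lemma constant_along_line:
  fixes g :: "'a::real_normed_vector \<Rightarrow> 'b::real_normed_vector"
  assumes "convex S" "p \<in> S" "p + h *\<^sub>R v \<in> S"
    and diff: "\<And>q. q \<in> S \<Longrightarrow> g differentiable (at q)"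
    and zero: "\<And>q. q \<in> S \<Longrightarrow> frechet_derivative g (at q) v = 0"
  shows "g (p + h *\<^sub>R v) = g p"
proof -
  have "p + t *\<^sub>R v \<in> S" if "t \<in> closed_segment 0 h" for t
  proof -
    obtain u where u: "0 \<le> u" "u \<le> 1" "t = u * h"
      using \<open>t \<in> closed_segment 0 h\<close> by (auto simp: in_segment)
    have "p + t *\<^sub>R v = (1 - u) *\<^sub>R p + u *\<^sub>R (p + h *\<^sub>R v)"
      by (simp add: u algebra_simps)
    also have "\<dots> \<in> S"
      using assms(1-3) u by (auto simp: convex_alt)
    finally show ?thesis .
  qed
  then have "((\<lambda>t. g (p + t *\<^sub>R v)) has_derivative (\<lambda>h. 0)) (at t within closed_segment 0 h)"
    if "t \<in> closed_segment 0 h" for t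
    using line_has_derivative[OF diff, of p t v] zero that
    by (auto simp: has_vector_derivative_def intro: has_derivative_at_withinI)
  then obtain c where c: "\<forall>t \<in> closed_segment 0 h. g (p + t *\<^sub>R v) = c"
    using has_derivative_zero_constant[OF convex_closed_segment] by blast
  have "g (p + h *\<^sub>R v) = g (p + 0 *\<^sub>R v)"
    using c[rule_format, of h] c[rule_format, of 0] by simp
  then show ?thesis
    by simp
qed

text \<open>
  A nonzero Gram determinant says that \<open>a\<close> and \<open>b\<close> span the plane.
\<close>

lemma orthogonal_to_basis_plane:
  fixes a b m :: "real^2"
  assumes "m \<bullet> a = 0" "m \<bullet> b = 0" and gram: "(a \<bullet> a) * (b \<bullet> b) - (a \<bullet> b)\<^sup>2 \<noteq> 0"
  shows "m = 0"
proof -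
  let ?d = "a$1 * b$2 - a$2 * b$1"
  have "(a \<bullet> a) * (b \<bullet> b) - (a \<bullet> b)\<^sup>2 = ?d\<^sup>2"
    by (simp add: inner_vec_def sum_2 power2_eq_square algebra_simps)
  then have "?d \<noteq> 0"
    using gram by auto
  have m: "m$1 * a$1 + m$2 * a$2 = 0" "m$1 * b$1 + m$2 * b$2 = 0"
    using assms(1,2) by (simp_all add: inner_vec_def sum_2)
  have "m$1 * ?d = 0" "m$2 * ?d = 0"
    using m by algebra+
  then show ?thesis
    using \<open>?d \<noteq> 0\<close> by (simp add: vec_eq_iff forall_2)
qed

text \<open>
  In the plane the orthogonal complement of \<open>b\<close> is the line through \<open>a\<close> and vice versa,
  so \<open>\<alpha>\<close> is parallel to \<open>a\<close>.  Here the dimension 2 enters: in \<open>\<real>\<^sup>3\<close> the statement fails.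
\<close>

lemma orthogonal_chain_plane:
  fixes a b \<alpha> \<beta> :: "real^2"
  assumes "a \<noteq> 0" "b \<noteq> 0" "a \<bullet> b = 0" "\<alpha> \<bullet> b = 0" "a \<bullet> \<beta> = 0"
  shows "\<alpha> \<bullet> \<beta> = 0"
proof -
  have "((a \<bullet> a) *\<^sub>R \<alpha> - (\<alpha> \<bullet> a) *\<^sub>R a) \<bullet> a = 0" "((a \<bullet> a) *\<^sub>R \<alpha> - (\<alpha> \<bullet> a) *\<^sub>R a) \<bullet> b = 0"
    using assms by (simp_all add: inner_diff_left)
  then have "(a \<bullet> a) *\<^sub>R \<alpha> - (\<alpha> \<bullet> a) *\<^sub>R a = 0"
    by (rule orthogonal_to_basis_plane) (use assms in simp)
  then have "((a \<bullet> a) *\<^sub>R \<alpha> - (\<alpha> \<bullet> a) *\<^sub>R a) \<bullet> \<beta> = 0"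
    by simp
  then have "(a \<bullet> a) * (\<alpha> \<bullet> \<beta>) = (\<alpha> \<bullet> a) * (a \<bullet> \<beta>)"
    by (simp add: inner_diff_left)
  then show ?thesis
    using assms by simp
qed

text \<open>
  If the squared length of a vector field is stationary in direction \<open>v\<close>, then the field changes
  orthogonally to itself.
\<close>

lemma derivative_of_square_length:
  fixes g :: "'a::real_normed_vector \<Rightarrow> 'b::real_inner"
  assumes "open S" "p \<in> S" and g: "g differentiable (at p)"
    and eq: "\<And>q. q \<in> S \<Longrightarrow> g q \<bullet> g q = \<phi> q" and \<phi>: "(\<phi> has_derivative \<phi>') (at p)" and "\<phi>' v = 0"
  shows "frechet_derivative g (at p) v \<bullet> g p = 0"
proof -
  have g': "(g has_derivative frechet_derivative g (at p)) (at p)"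
    using g frechet_derivative_works by blast
  have "((\<lambda>q. g q \<bullet> g q) has_derivative \<phi>') (at p)"
    using has_derivative_transform_within_open[OF \<phi> \<open>open S\<close> \<open>p \<in> S\<close>] eq by simp
  from has_derivative_unique[OF has_derivative_inner[OF g' g'] this]
  have "g p \<bullet> frechet_derivative g (at p) v + frechet_derivative g (at p) v \<bullet> g p = \<phi>' v"
    by (rule fun_cong)
  then show ?thesis
    using \<open>\<phi>' v = 0\<close> by (simp add: inner_commute)
qed

text \<open>
  The coordinate fields \<open>a\<close> and \<open>b\<close> of an isometry \<open>g\<close> into the plane have lengths that depend
  on one coordinate only, namely on the first for \<open>a\<close> and on the second for \<open>b\<close>.  The mixed
  derivative of \<open>g\<close> is therefore orthogonal to both fields and vanishes: \<open>a\<close> depends on the first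
  coordinate only and \<open>b\<close> on the second, and \<open>g\<close> is a sum of two plane curves.  On the coordinate
  axes \<open>a\<close> and \<open>b\<close> are orthogonal, so all values of \<open>a\<close> lie on one line and all values of \<open>b\<close> on
  the line perpendicular to it.  But off the axes the product \<open>a \<bullet> b\<close> is not zero.
\<close>

lemma not_planar_ball:
  assumes "r > 0"
  shows "\<not> planar_region quartic_saddle (ball 0 r)"
proof
  let ?D = "ball (0 :: real^2) r"
  let ?x = "axis 1 1 :: real^2" and ?y = "axis 2 1 :: real^2"
  assume "planar_region quartic_saddle ?D"
  then obtain g :: "real^2 \<Rightarrow> real^2" where g: "smooth_on ?D g"
    and isom: "\<And>p u v. p \<in> ?D \<Longrightarrow>
      frechet_derivative g (at p) u \<bullet> frechet_derivative g (at p) v = first_form quartic_saddle p u v"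
    unfolding planar_region_def by blast
  define a where "a p = frechet_derivative g (at p) ?x" for p
  define b where "b p = frechet_derivative g (at p) ?y" for p
  have E: "a p \<bullet> a p = 1 + 16 * (p$1)^6" and F: "a p \<bullet> b p = - 16 * (p$1)^3 * (p$2)^3"
    and G: "b p \<bullet> b p = 1 + 16 * (p$2)^6" if "p \<in> ?D" for p
    unfolding a_def b_def using isom[OF that]
    by (simp_all add: quartic_saddle_first_form axis_def flip: power_add)
  have diff: "a differentiable (at p)" "b differentiable (at p)" if "p \<in> ?D" for p
    using smooth_on_differentiable[OF smooth_on_directional_derivative[OF g] that]
    by (simp_all add: a_def[abs_def] b_def[abs_def])
  have mixed: "frechet_derivative a (at p) ?y = 0 \<and> frechet_derivative b (at p) ?x = 0"
    if p: "p \<in> ?D" for p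
  proof -
    let ?m = "frechet_derivative a (at p) ?y"
    have sym: "?m = frechet_derivative b (at p) ?x"
      unfolding a_def[abs_def] b_def[abs_def] by (rule second_derivative_symmetric[OF g open_ball p])
    have "?m \<bullet> a p = 0"
      by (rule derivative_of_square_length[OF open_ball p diff(1)[OF p] E, where \<phi>' = "\<lambda>v. 96 * (p$1)^5 * v$1"])
         (auto intro!: derivative_eq_intros bounded_linear.has_derivative[OF bounded_linear_vec_nth] simp: axis_def)
    moreover have "frechet_derivative b (at p) ?x \<bullet> b p = 0"
      by (rule derivative_of_square_length[OF open_ball p diff(2)[OF p] G, where \<phi>' = "\<lambda>v. 96 * (p$2)^5 * v$2"])
         (auto intro!: derivative_eq_intros bounded_linear.has_derivative[OF bounded_linear_vec_nth] simp: axis_def)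
    moreover have "(a p \<bullet> a p) * (b p \<bullet> b p) - (a p \<bullet> b p)\<^sup>2 = 1 + 16 * (p$1)^6 + 16 * (p$2)^6"
      unfolding E[OF p] F[OF p] G[OF p] by algebra
    moreover have "\<dots> > 0"
      by (intro add_pos_nonneg) (simp_all add: zero_le_even_power)
    ultimately have "?m = 0"
      using orthogonal_to_basis_plane[of ?m "a p" "b p"] sym by simp
    then show ?thesis
      using sym by simp
  qed
  \<comment> \<open>A square with side \<open>s\<close> and one corner at the origin fits into the disc.\<close>
  define s where "s = r / 2"
  have "s > 0"
    using assms by (simp add: s_def)
  have norm_corner: "norm (s *\<^sub>R ?x + s *\<^sub>R ?y) < r"
  proof -
    have "(s *\<^sub>R ?x + s *\<^sub>R ?y) \<bullet> (s *\<^sub>R ?x + s *\<^sub>R ?y) = r\<^sup>2 / 2"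
      by (simp add: inner_vec_def sum_2 axis_def s_def power2_eq_square)
    also have "\<dots> < r\<^sup>2"
      using assms by simp
    finally show ?thesis
      using assms by (simp add: norm_eq_sqrt_inner real_less_lsqrt)
  qed
  have D: "0 \<in> ?D" "s *\<^sub>R ?x \<in> ?D" "s *\<^sub>R ?y \<in> ?D" "s *\<^sub>R ?x + s *\<^sub>R ?y \<in> ?D" "s *\<^sub>R ?y + s *\<^sub>R ?x \<in> ?D"
    using assms norm_corner by (simp_all add: s_def add.commute)
  have a_const: "a (p + s *\<^sub>R ?y) = a p" if "p \<in> ?D" "p + s *\<^sub>R ?y \<in> ?D" for p
    by (rule constant_along_line[OF convex_ball that]) (simp_all add: diff mixed)
  have b_const: "b (p + s *\<^sub>R ?x) = b p" if "p \<in> ?D" "p + s *\<^sub>R ?x \<in> ?D" for p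
    by (rule constant_along_line[OF convex_ball that]) (simp_all add: diff mixed)
  have "a 0 \<bullet> b 0 = 0"
    using F[OF D(1)] by simp
  moreover have "a (s *\<^sub>R ?x) \<bullet> b 0 = 0"
    using F[OF D(2)] b_const[of 0] D by (simp add: axis_def)
  moreover have "a 0 \<bullet> b (s *\<^sub>R ?y) = 0"
    using F[OF D(3)] a_const[of 0] D by (simp add: axis_def)
  moreover have "a 0 \<noteq> 0" "b 0 \<noteq> 0"
    using E[OF D(1)] G[OF D(1)] by auto
  ultimately have "a (s *\<^sub>R ?x) \<bullet> b (s *\<^sub>R ?y) = 0"
    using orthogonal_chain_plane by blast
  moreover have "a (s *\<^sub>R ?x + s *\<^sub>R ?y) \<bullet> b (s *\<^sub>R ?x + s *\<^sub>R ?y) = - 16 * s^3 * s^3"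
    using F[OF D(4)] by (simp add: axis_def)
  moreover have "a (s *\<^sub>R ?x + s *\<^sub>R ?y) = a (s *\<^sub>R ?x)"
    using a_const D by blast
  moreover have "b (s *\<^sub>R ?x + s *\<^sub>R ?y) = b (s *\<^sub>R ?y)"
    using b_const[of "s *\<^sub>R ?y"] D by (simp add: add.commute)
  ultimately show False
    using \<open>s > 0\<close> by simp
qed

theorem theorem2p1:
  shows "\<exists>f :: real^2 \<Rightarrow> real^3. saddle_plane f \<and>
           infinite {range c | c. closed_asymptotic_curve f c \<and>
                                  \<not> planar_region f (inside (range c))}"
proof (intro exI conjI)
  show "saddle_plane quartic_saddle"
    by (rule saddle_plane_quartic_saddle)
  have "inj_on (\<lambda>r. range (circle r)) {0<..}"
  proof (rule inj_onI)
    fix r s :: real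
    assume "r \<in> {0<..}" "s \<in> {0<..}" "range (circle r) = range (circle s)"
    then have "sphere (0 :: real^2) r = sphere 0 s" and "r > 0"
      by (simp_all add: range_circle)
    moreover have "r *\<^sub>R axis 1 1 \<in> sphere (0 :: real^2) r"
      using \<open>r > 0\<close> by simp
    ultimately have "r *\<^sub>R axis 1 1 \<in> sphere (0 :: real^2) s"
      by blast
    then show "r = s"
      using \<open>r > 0\<close> by simp
  qed
  then have "infinite ((\<lambda>r. range (circle r)) ` {0<..})"
    using infinite_Ioi[of "0 :: real"] by (simp add: finite_image_iff)
  moreover have "(\<lambda>r. range (circle r)) ` {0<..} \<subseteq>
      {range c | c. closed_asymptotic_curve quartic_saddle c \<and>
                    \<not> planar_region quartic_saddle (inside (range c))}"
  proof
    fix C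
    assume "C \<in> (\<lambda>r. range (circle r)) ` {0<..}"
    then obtain r where "r > 0" and C: "C = range (circle r)"
      by auto
    then have "closed_asymptotic_curve quartic_saddle (circle r)"
      and "\<not> planar_region quartic_saddle (inside (range (circle r)))"
      by (simp_all add: closed_asymptotic_circle not_planar_ball inside_circle)
    then show "C \<in> {range c | c. closed_asymptotic_curve quartic_saddle c \<and>
                    \<not> planar_region quartic_saddle (inside (range c))}"
      unfolding C by blast
  qed
  ultimately show "infinite {range c | c. closed_asymptotic_curve quartic_saddle c \<and>
                    \<not> planar_region quartic_saddle (inside (range c))}"
    using infinite_super by blast
qed

end
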